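(* There exists a D-regularly nil clean ring that is neither clean nor strongly clean.
   Context: All rings are associative with identity (not necessarily commutative). A ring $R$ is called D-regularly nil clean if for every $a\in R$ there exists an idempotent $e\in aRa$ such that $a(1-e)$ is nilpotent. A ring $R$ is called clean if every element $r\in R$ can be written as $r=e+u$ with $e$ idempotent and $u$ a unit, and strongly clean if every element can be so written with additionally $eu=ue$. *)

theory Defs
  imports
    "HOL-Algebra.Ring"
    "HOL-Library.Z2"
    "HOL-Computational_Algebra.Formal_Power_Series"
begin

text \<open>
  The predicates below are meant for noncommutative unital rings, i.e. they are used
  together with \<^term>\<open>ring R\<close>.
\<close>

definition idempotent_elem :: "('a, 'b) ring_scheme \<Rightarrow> 'a \<Rightarrow> bool" where
  "idempotent_elem R e \<longleftrightarrow> e \<in> carrier R \<and> e \<otimes>\<^bsub>R\<^esub> e = e"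

definition nilpotent_elem :: "('a, 'b) ring_scheme \<Rightarrow> 'a \<Rightarrow> bool" where
  "nilpotent_elem R x \<longleftrightarrow> x \<in> carrier R \<and> (\<exists>n::nat. n > 0 \<and> x [^]\<^bsub>R\<^esub> n = \<zero>\<^bsub>R\<^esub>)"

definition D_regularly_nil_clean :: "('a, 'b) ring_scheme \<Rightarrow> bool" where
  "D_regularly_nil_clean R \<longleftrightarrow>
     (\<forall>a\<in>carrier R. \<exists>e. idempotent_elem R e \<and>
        (\<exists>r\<in>carrier R. e = a \<otimes>\<^bsub>R\<^esub> r \<otimes>\<^bsub>R\<^esub> a) \<and>
        nilpotent_elem R (a \<otimes>\<^bsub>R\<^esub> (\<one>\<^bsub>R\<^esub> \<ominus>\<^bsub>R\<^esub> e)))"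

definition clean_ring :: "('a, 'b) ring_scheme \<Rightarrow> bool" where
  "clean_ring R \<longleftrightarrow>
     (\<forall>r\<in>carrier R. \<exists>e u. idempotent_elem R e \<and> u \<in> Units R \<and> r = e \<oplus>\<^bsub>R\<^esub> u)"

definition strongly_clean_ring :: "('a, 'b) ring_scheme \<Rightarrow> bool" where
  "strongly_clean_ring R \<longleftrightarrow>
     (\<forall>r\<in>carrier R. \<exists>e u. idempotent_elem R e \<and> u \<in> Units R \<and> r = e \<oplus>\<^bsub>R\<^esub> u \<and>
        e \<otimes>\<^bsub>R\<^esub> u = u \<otimes>\<^bsub>R\<^esub> e)"

text \<open>
  HOL cannot quantify existentially over types, so an existence statement about rings has
  to name a type from which the carrier (an arbitrary subset) is drawn.  The type below
  plays no role beyond its cardinality: it contains a copy of every set of size at most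
  two to the power of the continuum.  Nothing is lost by fixing it, because a ring with the
  properties in question has a countable unital subring with the same properties (start with
  an element witnessing that the ring is not clean and close under the ring operations and
  under chosen witnesses \<open>e\<close> and \<open>r\<close>).
\<close>

type_synonym ring_universe = "bit fps \<Rightarrow> bit fps"

end

theory Submission
  imports Defs
begin

text \<open>
  Every von Neumann regular ring is D-regularly nil clean: if \<open>y\<close> is a reflexive inverse of
  \<open>a\<^sup>2\<close>, then \<open>e = a y a\<close> is an idempotent with \<open>a (1 - e) a = 0\<close>.  Bergman's example is
  regular but not clean.  It consists of the linear endomorphisms of \<open>F[[X]]\<close> that agree on
  some ideal \<open>X\<^sup>n F[[X]]\<close> with multiplication by some Laurent series \<open>q\<close>.  An idempotent has
  \<open>q \<in> {0, 1}\<close>, and an injective operator has \<open>q\<close> of nonnegative valuation on counting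
  dimensions of \<open>F[[X]] / X\<^sup>n F[[X]]\<close>, so the backward shift, where \<open>q = 1/X\<close>, is not the
  sum of an idempotent and a unit.  Over the field with two elements linear maps are just
  additive maps, and dimensions can be counted as cardinalities.
\<close>

section \<open>Von Neumann regularity yields D-regular nil cleanness\<close>

lemma (in ring) regular_imp_D_regularly_nil_clean:
  assumes reg: "\<And>a. a \<in> carrier R \<Longrightarrow> \<exists>x\<in>carrier R. a \<otimes> x \<otimes> a = a"
  shows "D_regularly_nil_clean R"
  unfolding D_regularly_nil_clean_def
proof
  fix a assume a[simp]: "a \<in> carrier R"
  obtain x where x[simp]: "x \<in> carrier R" and axa: "(a \<otimes> a) \<otimes> x \<otimes> (a \<otimes> a) = a \<otimes> a"
    using reg[of "a \<otimes> a"] by auto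
  \<comment> \<open>Sandwiching an inner inverse \<open>x\<close> of \<open>a \<otimes> a\<close>
    makes it reflexive. The law \<open>aya\<close> will give
    \<open>a \<otimes> e \<otimes> a = a \<otimes> a\<close>, and \<open>yay\<close> will make
    \<open>e\<close> idempotent.\<close>
  define y where "y = x \<otimes> (a \<otimes> a) \<otimes> x"
  have y[simp]: "y \<in> carrier R" by (simp add: y_def)
  have "(a \<otimes> a) \<otimes> y \<otimes> (a \<otimes> a) = ((a \<otimes> a) \<otimes> x \<otimes> (a \<otimes> a)) \<otimes> x \<otimes> (a \<otimes> a)"
    by (simp add: y_def m_assoc)
  hence aya: "(a \<otimes> a) \<otimes> y \<otimes> (a \<otimes> a) = a \<otimes> a" by (simp only: axa)
  have "y \<otimes> (a \<otimes> a) \<otimes> y = x \<otimes> ((a \<otimes> a) \<otimes> x \<otimes> (a \<otimes> a)) \<otimes> x \<otimes> (a \<otimes> a) \<otimes> x"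
    by (simp add: y_def m_assoc)
  also have "\<dots> = x \<otimes> (a \<otimes> a) \<otimes> x \<otimes> (a \<otimes> a) \<otimes> x" by (simp only: axa)
  also have "\<dots> = x \<otimes> ((a \<otimes> a) \<otimes> x \<otimes> (a \<otimes> a)) \<otimes> x" by (simp add: m_assoc)
  also have "\<dots> = y" by (simp only: axa) (simp add: y_def)
  finally have yay: "y \<otimes> (a \<otimes> a) \<otimes> y = y" .
  define e where "e = a \<otimes> y \<otimes> a"
  have e[simp]: "e \<in> carrier R" by (simp add: e_def)
  have "e \<otimes> e = a \<otimes> (y \<otimes> (a \<otimes> a) \<otimes> y) \<otimes> a" by (simp add: e_def m_assoc)
  hence idem: "e \<otimes> e = e" by (simp only: yay) (simp add: e_def)
  have aea: "a \<otimes> e \<otimes> a = a \<otimes> a" using aya by (simp add: e_def m_assoc)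
  define b where "b = a \<otimes> (\<one> \<ominus> e)"
  have b[simp]: "b \<in> carrier R" by (simp add: b_def)
  have "b \<otimes> a = a \<otimes> a \<ominus> a \<otimes> e \<otimes> a" by (simp add: b_def minus_eq r_distr l_distr r_minus l_minus)
  hence "b \<otimes> a = \<zero>" by (simp add: aea minus_eq r_neg)
  \<comment> \<open>Only the second factor is unfolded, so that \<open>b \<otimes> a\<close> appears
    on the left of the product.\<close>
  hence "b \<otimes> b = \<zero>" by (subst (2) b_def) (simp add: m_assoc[symmetric])
  hence "b [^] (2::nat) = \<zero>" by (simp add: numeral_2_eq_2)
  hence "nilpotent_elem R b" by (auto simp: nilpotent_elem_def intro!: exI[of _ "2::nat"])
  thus "\<exists>e. idempotent_elem R e \<and> (\<exists>r\<in>carrier R. e = a \<otimes> r \<otimes> a) \<and>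
          nilpotent_elem R (a \<otimes> (\<one> \<ominus> e))"
    using idem y by (intro exI[of _ e]) (auto simp: idempotent_elem_def b_def e_def)
qed

section \<open>Bergman's ring of operators on power series\<close>

text \<open>The multiplier \<open>q\<close> is encoded by the power series \<open>p = q X\<^sup>n\<close>.\<close>
definition multiplier :: "('a::field fps \<Rightarrow> 'a fps) \<Rightarrow> nat \<Rightarrow> 'a fps \<Rightarrow> bool" where
  "multiplier r n p \<longleftrightarrow> (\<forall>b. r (fps_X ^ n * b) = p * b)"

definition bergman_carrier :: "('a::field fps \<Rightarrow> 'a fps) set" where
  "bergman_carrier = {r. additive r \<and> (\<exists>n p. multiplier r n p)}"

definition bergman_ring :: "('a::field fps \<Rightarrow> 'a fps) ring" where
  "bergman_ring = \<lparr>carrier = bergman_carrier, monoid.mult = (\<circ>), one = id,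
     zero = (\<lambda>_. 0), add = (\<lambda>r s a. r a + s a)\<rparr>"

text \<open>The encoding of \<open>q\<close> depends on the exponent: \<open>q\<close> times
  \<open>fps_X ^ (n + k)\<close> is \<open>fps_X ^ k * p\<close>. This brings two operators, or two
  encodings of one operator, to a common ideal.\<close>

lemma multiplier_mono:
  assumes "multiplier r n p"
  shows "multiplier r (n + k) (fps_X ^ k * p)"
  unfolding multiplier_def
proof
  fix b
  have "r (fps_X ^ n * (fps_X ^ k * b)) = p * (fps_X ^ k * b)"
    using assms unfolding multiplier_def by blast
  thus "r (fps_X ^ (n + k) * b) = fps_X ^ k * p * b"
    by (simp only: power_add mult_ac)
qed

lemma multiplier_add:
  assumes "multiplier r n p" "multiplier s m q"
  shows "multiplier (\<lambda>a. r a + s a) (n + m) (fps_X ^ m * p + fps_X ^ n * q)"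
  using multiplier_mono[OF assms(1), of m] multiplier_mono[OF assms(2), of n]
  by (simp add: multiplier_def add.commute distrib_right)

text \<open>The exponents add because \<open>s\<close> must send the chosen ideal into the multiples
  of \<open>fps_X ^ n\<close>, where \<open>r\<close> acts as a multiplication.\<close>

lemma multiplier_comp:
  assumes "multiplier r n p" "multiplier s m q"
  shows "multiplier (r \<circ> s) (m + n) (p * q)"
  unfolding multiplier_def
proof
  fix b
  have "s (fps_X ^ (m + n) * b) = fps_X ^ n * (q * b)"
    using multiplier_mono[OF assms(2), of n] by (simp add: multiplier_def mult.assoc)
  thus "(r \<circ> s) (fps_X ^ (m + n) * b) = p * q * b"
    using assms(1) by (simp add: multiplier_def mult.assoc)
qed

lemma bergman_carrierI: "additive r \<Longrightarrow> multiplier r n p \<Longrightarrow> r \<in> bergman_carrier"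
  by (auto simp: bergman_carrier_def)

lemma bergman_carrierE:
  assumes "r \<in> bergman_carrier"
  obtains n p where "additive r" "multiplier r n p"
  using assms by (auto simp: bergman_carrier_def)

lemma bergman_add_closed:
  assumes "r \<in> bergman_carrier" "s \<in> bergman_carrier"
  shows "(\<lambda>a. r a + s a) \<in> bergman_carrier"
  using assms
  by (elim bergman_carrierE)
     (rule bergman_carrierI[OF _ multiplier_add], auto simp: additive_def)

lemma bergman_comp_closed:
  assumes "r \<in> bergman_carrier" "s \<in> bergman_carrier"
  shows "r \<circ> s \<in> bergman_carrier"
  using assms
  by (elim bergman_carrierE)
     (rule bergman_carrierI[OF _ multiplier_comp], auto simp: additive_def)

lemma bergman_uminus_closed:
  assumes "r \<in> bergman_carrier"
  shows "(\<lambda>a. - r a) \<in> bergman_carrier"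
proof -
  obtain n p where "additive r" "multiplier r n p" using assms by (rule bergman_carrierE)
  thus ?thesis by (intro bergman_carrierI[of _ n "- p"]) (auto simp: additive_def multiplier_def)
qed

lemma bergman_zero_closed: "(\<lambda>_. 0) \<in> bergman_carrier"
  by (rule bergman_carrierI[of _ 0 0]) (auto simp: additive_def multiplier_def)

lemma bergman_id_closed: "id \<in> bergman_carrier"
  by (rule bergman_carrierI[of _ 0 1]) (auto simp: additive_def multiplier_def)

lemma ring_bergman_ring: "ring (bergman_ring :: ('a::field fps \<Rightarrow> 'a fps) ring)" (is "ring ?R")
proof (rule ringI)
  show "abelian_group ?R"
  proof (rule abelian_groupI)
    fix x :: "'a fps \<Rightarrow> 'a fps" assume "x \<in> carrier ?R"
    thus "\<exists>y\<in>carrier ?R. y \<oplus>\<^bsub>?R\<^esub> x = \<zero>\<^bsub>?R\<^esub>"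
      by (intro bexI[of _ "\<lambda>a. - x a"]) (auto simp: bergman_ring_def bergman_uminus_closed)
  qed (auto simp: bergman_ring_def add_ac bergman_add_closed bergman_zero_closed)
  show "monoid ?R"
    by (rule monoidI) (auto simp: bergman_ring_def bergman_comp_closed bergman_id_closed)
next
  fix x y z :: "'a fps \<Rightarrow> 'a fps"
  assume "x \<in> carrier ?R" "y \<in> carrier ?R" "z \<in> carrier ?R"
  thus "z \<otimes>\<^bsub>?R\<^esub> (x \<oplus>\<^bsub>?R\<^esub> y) =
    z \<otimes>\<^bsub>?R\<^esub> x \<oplus>\<^bsub>?R\<^esub> z \<otimes>\<^bsub>?R\<^esub> y"
    by (auto simp: bergman_ring_def bergman_carrier_def additive_def)
qed (auto simp: bergman_ring_def)

section \<open>Linear algebra over the field with two elements\<close>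

instance bit :: finite
proof
  have *: "(UNIV :: bit set) = {0, 1}" using bit_not_zero_iff by blast
  show "finite (UNIV :: bit set)" unfolding * by blast
qed

interpretation bit_fps: vector_space "\<lambda>(c::bit) (a::bit fps). fps_const c * a"
  by unfold_locales
     (simp_all only: distrib_left distrib_right fps_const_add[symmetric] fps_const_mult[symmetric]
       mult.assoc fps_const_1_eq_1 mult_1)

interpretation bit_fps_pair: vector_space_pair
  "\<lambda>(c::bit) (a::bit fps). fps_const c * a" "\<lambda>(c::bit) (a::bit fps). fps_const c * a"
  by unfold_locales

lemma additive_iff_linear:
  fixes f :: "bit fps \<Rightarrow> bit fps"
  shows "additive f \<longleftrightarrow> Vector_Spaces.linear (\<lambda>c a. fps_const c * a) (\<lambda>c a. fps_const c * a) f"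
proof
  assume f: "additive f"
  have "f (fps_const c * a) = fps_const c * f a" for c a
    using additive.zero[OF f] by (cases c) simp_all
  thus "Vector_Spaces.linear (\<lambda>c a. fps_const c * a) (\<lambda>c a. fps_const c * a) f"
    using f bit_fps.vector_space_axioms by (simp add: Vector_Spaces.linear_iff additive_def)
qed (simp add: Vector_Spaces.linear_iff additive_def)

text \<open>A linear section of \<open>f\<close> over its range, extended to the whole space. As
  \<open>f\<close> may fail to be surjective, it is only an inner inverse.\<close>

lemma additive_right_inverse:
  fixes f :: "bit fps \<Rightarrow> bit fps"
  assumes "additive f"
  obtains g where "additive g" "\<And>a. f (g (f a)) = f a"
  using bit_fps_pair.linear_exists_right_inverse_on[of f UNIV] assms bit_fps.subspace_UNIV
  by (auto simp: additive_iff_linear)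

lemma additive_left_inverse_on_range:
  fixes f h :: "bit fps \<Rightarrow> bit fps"
  assumes f: "additive f" and h: "additive h" and inj: "inj_on f (range h)"
  obtains g where "additive g" "\<And>a. g (f (h a)) = h a"
proof -
  interpret h: Vector_Spaces.linear "\<lambda>c a. fps_const c * a" "\<lambda>c a. fps_const c * a" h
    using h by (simp add: additive_iff_linear)
  have "bit_fps.subspace (range h)"
    using h.subspace_image[OF bit_fps.subspace_UNIV] .
  thus ?thesis
    using bit_fps_pair.linear_exists_left_inverse_on[of f "range h"] f inj that
    by (auto simp: additive_iff_linear)
qed

section \<open>Regularity of Bergman's ring\<close>

lemma finite_range_fps_cutoff: "finite (range (fps_cutoff n :: 'a::{finite,zero} fps \<Rightarrow> _))"
proof (rule finite_subset)
  show "range (fps_cutoff n) \<subseteq> (\<lambda>f. Abs_fps (\<lambda>i. if i < n then f i else 0 :: 'a)) ` ({..<n} \<rightarrow>\<^sub>E UNIV)"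
  proof safe
    fix a :: "'a fps"
    have "fps_cutoff n a = Abs_fps (\<lambda>i. if i < n then restrict (fps_nth a) {..<n} i else 0)"
      by (auto simp: fps_eq_iff)
    thus "fps_cutoff n a \<in>
      (\<lambda>f. Abs_fps (\<lambda>i. if i < n then f i else 0 :: 'a)) ` ({..<n} \<rightarrow>\<^sub>E UNIV)"
      by (intro image_eqI[of _ _ "restrict (fps_nth a) {..<n}"]) auto
  qed
  show "finite ((\<lambda>f. Abs_fps (\<lambda>i. if i < n then f i else 0 :: 'a)) ` ({..<n} \<rightarrow>\<^sub>E UNIV))"
    by (intro finite_imageI finite_PiE) auto
qed

text \<open>The case \<open>q = 0\<close>. The range of \<open>r\<close> is finite, so a long enough
  cutoff is injective on it. The inner inverse cuts off, recovers the value in the range, and picks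
  a preimage; the cutoff makes it vanish on an ideal.\<close>

lemma bergman_regular_finite_rank:
  fixes r :: "bit fps \<Rightarrow> bit fps"
  assumes r: "additive r" and mult: "multiplier r n 0"
  shows "\<exists>s\<in>bergman_carrier. r \<circ> s \<circ> r = r"
proof -
  have "r a = r (fps_cutoff n a)" for a
  proof -
    have "r (fps_X ^ n * fps_shift n a + fps_cutoff n a) = r (fps_cutoff n a)"
      using mult additive.add[OF r] by (simp add: multiplier_def)
    thus ?thesis by (simp only: fps_shift_cutoff')
  qed
  hence "range r \<subseteq> r ` range (fps_cutoff n)" by blast
  hence fin: "finite (range r)"
    by (rule finite_subset[OF _ finite_imageI[OF finite_range_fps_cutoff]])
  \<comment> \<open>Beyond the subdegree of every value of \<open>r\<close>, so the cutoff kills no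
    nonzero value.\<close>
  define m where "m = Suc (Max (subdegree ` range r))"
  have m: "subdegree (r a) < m" for a
    using fin by (auto simp: m_def less_Suc_eq_le intro!: Max_ge)
  have cut: "additive (fps_cutoff m :: bit fps \<Rightarrow> _)"
    by (simp add: additive_def fps_cutoff_add)
  have "inj_on (fps_cutoff m) (range r)"
  proof (rule inj_onI, clarify)
    fix a b assume "fps_cutoff m (r a) = fps_cutoff m (r b)"
    hence "fps_cutoff m (r (a - b)) = 0"
      using additive.diff[OF r] by (simp add: fps_cutoff_diff)
    hence "r (a - b) = 0" using m[of "a - b"] by (auto simp: fps_cutoff_zero_iff)
    thus "r a = r b" using additive.diff[OF r] by simp
  qed
  then obtain h where h: "additive h" "\<And>a. h (fps_cutoff m (r a)) = r a"
    using additive_left_inverse_on_range[OF cut r] by blast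
  obtain g where g: "additive g" "\<And>a. r (g (r a)) = r a"
    using additive_right_inverse[OF r] by blast
  define s where "s = g \<circ> h \<circ> fps_cutoff m"
  have "fps_cutoff m (fps_X ^ m * b) = 0" for b :: "bit fps"
    by (simp add: fps_eq_iff fps_X_power_mult_nth)
  hence "multiplier s m 0"
    using additive.zero[OF h(1)] additive.zero[OF g(1)] by (simp add: multiplier_def s_def)
  moreover have "additive s"
    using g h cut by (auto simp: additive_def s_def)
  ultimately have "s \<in> bergman_carrier" by (intro bergman_carrierI)
  moreover have "r \<circ> s \<circ> r = r" by (auto simp: s_def h g fun_eq_iff)
  ultimately show ?thesis by blast
qed

text \<open>Here \<open>q\<close> is invertible as a Laurent series. The inner inverse divides by
  \<open>q\<close> on the multiples of \<open>fps_X ^ m\<close> and applies \<open>g\<close> to the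
  finitely many lower coefficients.\<close>

lemma bergman_regular_fredholm:
  fixes r :: "bit fps \<Rightarrow> bit fps"
  assumes r: "additive r" and mult: "multiplier r n p" and p: "p \<noteq> 0"
  shows "\<exists>s\<in>bergman_carrier. r \<circ> s \<circ> r = r"
proof -
  obtain g where g: "additive g" "\<And>a. r (g (r a)) = r a"
    using additive_right_inverse[OF r] by blast
  define m where "m = subdegree p"
  define w where "w = unit_factor p"
  have pw: "p = w * fps_X ^ m"
    unfolding w_def m_def by (rule subdegree_decompose[of p, folded fps_unit_factor_def])
  have w: "inverse w * w = 1" by (rule inverse_mult_eq_1) (use p in \<open>simp add: w_def\<close>)
  \<comment> \<open>This is \<open>fps_X ^ m * c\<close> divided by \<open>q\<close>, since
    \<open>q\<close> times \<open>fps_X ^ n\<close> is \<open>w * fps_X ^ m\<close>.\<close>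
  define t where "t c = fps_X ^ n * inverse w * c" for c
  have rt: "r (t c) = fps_X ^ m * c" for c
  proof -
    have "r (t c) = fps_X ^ m * c * (inverse w * w)"
      using mult[unfolded multiplier_def, rule_format, of "inverse w * c"]
      by (simp add: t_def pw mult_ac)
    thus ?thesis by (simp add: w)
  qed
  define s where "s y = g (fps_cutoff m y) + t (fps_shift m y)" for y
  have "fps_cutoff m (fps_X ^ m * b) = 0" "fps_shift m (fps_X ^ m * b) = b" for b :: "bit fps"
    by (simp_all add: fps_eq_iff fps_X_power_mult_nth)
  hence "multiplier s m (fps_X ^ n * inverse w)"
    using additive.zero[OF g(1)] by (simp add: multiplier_def s_def t_def)
  moreover have "additive s"
    using g by (auto simp: additive_def s_def t_def fps_cutoff_add fps_shift_add algebra_simps)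
  ultimately have "s \<in> bergman_carrier" by (intro bergman_carrierI)
  moreover have "r (s (r a)) = r a" for a
  proof -
    \<comment> \<open>The cutoff of \<open>r a\<close> differs from \<open>r a\<close> by a value of
      \<open>r\<close>, so it lies in the range of \<open>r\<close>, where \<open>g\<close> gives
      preimages.\<close>
    have "r (a - t (fps_shift m (r a))) = r a - fps_X ^ m * fps_shift m (r a)"
      by (simp add: additive.diff[OF r] rt)
    also have "\<dots> = fps_cutoff m (r a)"
      using fps_shift_cutoff'[of m "r a"] by (metis add_diff_cancel_left')
    finally have "r (g (fps_cutoff m (r a))) = fps_cutoff m (r a)" by (metis g(2))
    hence "r (s (r a)) = fps_cutoff m (r a) + fps_X ^ m * fps_shift m (r a)"
      by (simp add: s_def additive.add[OF r] rt)
    thus ?thesis using fps_shift_cutoff'[of m "r a"] by (simp only: add.commute)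
  qed
  ultimately show ?thesis by (intro bexI[of _ s]) (auto simp: fun_eq_iff)
qed

lemma bergman_regular:
  fixes r :: "bit fps \<Rightarrow> bit fps"
  assumes "r \<in> bergman_carrier"
  shows "\<exists>s\<in>bergman_carrier. r \<circ> s \<circ> r = r"
  using assms bergman_regular_finite_rank bergman_regular_fredholm
  by (elim bergman_carrierE) metis

section \<open>Failure of cleanness\<close>

lemma idempotent_multiplier:
  assumes "multiplier e n p" "e \<circ> e = e"
  shows "p = 0 \<or> p = fps_X ^ n"
proof -
  \<comment> \<open>Two encodings of the multiplier of \<open>e\<close> at exponent
    \<open>n + n\<close> are compared at \<open>b = 1\<close>; they express that \<open>q\<close>
    squared is \<open>q\<close>.\<close>
  have "multiplier e (n + n) (p * p)" using multiplier_comp[OF assms(1,1)] assms(2) by simp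
  hence "p * p = fps_X ^ n * p"
    using multiplier_mono[OF assms(1), of n] unfolding multiplier_def by (metis mult.right_neutral)
  thus ?thesis by simp
qed

text \<open>As \<open>w\<close> is a unit, \<open>u\<close> maps the multiples of
  \<open>fps_X ^ n\<close> onto those of \<open>fps_X ^ m\<close>. Being injective, it embeds the
  quotient by the first ideal into the quotient by the second, and counting elements gives the
  bound.\<close>

lemma inj_multiplier_subdegree_ge:
  fixes u :: "'a::{field,finite} fps \<Rightarrow> 'a fps"
  assumes u: "additive u" and inj: "inj u" and mult: "multiplier u n (fps_X ^ m * w)"
    and w: "fps_nth w 0 \<noteq> 0"
  shows "n \<le> m"
proof -
  \<comment> \<open>\<open>F\<close> lists representatives modulo \<open>fps_X ^ n\<close>;
    \<open>G\<close> reads their images modulo \<open>fps_X ^ m\<close>. Both quotients become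
    finite function spaces.\<close>
  define F where "F f = Abs_fps (\<lambda>i. if i < n then f i else 0 :: 'a)" for f
  define G where "G f = restrict (fps_nth (u (F f))) {..<m}" for f
  have "inj_on G ({..<n} \<rightarrow>\<^sub>E UNIV)"
  proof (rule inj_onI)
    fix f g assume f: "f \<in> {..<n} \<rightarrow>\<^sub>E UNIV" and g: "g \<in> {..<n} \<rightarrow>\<^sub>E UNIV" and fg: "G f = G g"
    define d where "d = u (F f - F g)"
    have "fps_nth d i = 0" if "i < m" for i
      using fun_cong[OF fg, of i] that by (simp add: G_def d_def additive.diff[OF u])
    hence "fps_cutoff m d = 0" by (simp add: fps_eq_iff)
    hence "d = fps_X ^ m * fps_shift m d" using fps_shift_cutoff'[of m d] by simp
    \<comment> \<open>Inserting \<open>inverse w * w\<close> exhibits \<open>d\<close> as the image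
      under \<open>u\<close> of a multiple of \<open>fps_X ^ n\<close>.\<close>
    also have "\<dots> = fps_X ^ m * fps_shift m d * (inverse w * w)"
      by (simp add: inverse_mult_eq_1[OF w])
    also have "\<dots> = u (fps_X ^ n * (inverse w * fps_shift m d))"
      using mult[unfolded multiplier_def, rule_format, of "inverse w * fps_shift m d"]
      by (simp add: mult_ac)
    finally have *: "F f - F g = fps_X ^ n * (inverse w * fps_shift m d)"
      using inj by (simp add: d_def inj_eq)
    have eq: "f i = g i" if "i < n" for i
      using arg_cong[OF *, of "\<lambda>a. fps_nth a i"] that by (simp add: F_def fps_X_power_mult_nth)
    show "f = g" by (rule PiE_ext[OF f g]) (simp add: eq)
  qed
  moreover have "G ` ({..<n} \<rightarrow>\<^sub>E UNIV) \<subseteq> {..<m} \<rightarrow>\<^sub>E UNIV"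
    by (rule image_subsetI) (simp add: G_def)
  moreover have "finite ({..<m} \<rightarrow>\<^sub>E (UNIV :: 'a set))"
    by (rule finite_PiE) simp_all
  ultimately have "card ({..<n} \<rightarrow>\<^sub>E (UNIV :: 'a set)) \<le> card ({..<m} \<rightarrow>\<^sub>E (UNIV :: 'a set))"
    by (rule card_inj_on_le)
  hence "card (UNIV :: 'a set) ^ n \<le> card (UNIV :: 'a set) ^ m" by (simp add: card_PiE)
  \<comment> \<open>The base is at least 2, so the powers compare as their exponents do.\<close>
  moreover have "card {0, 1 :: 'a} \<le> card (UNIV :: 'a set)" by (intro card_mono) auto
  ultimately show ?thesis by (simp add: power_increasing_iff)
qed

lemma bergman_ring_not_clean: "\<not> clean_ring (bergman_ring :: (('a::{field,finite}) fps \<Rightarrow> 'a fps) ring)"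
proof
  let ?R = "bergman_ring :: ('a fps \<Rightarrow> 'a fps) ring"
  assume clean: "clean_ring ?R"
  have shift: "multiplier (fps_shift 1 :: 'a fps \<Rightarrow> 'a fps) 1 1"
    by (auto simp: multiplier_def fps_eq_iff fps_X_power_mult_nth)
  have "additive (fps_shift 1 :: 'a fps \<Rightarrow> 'a fps)" by (simp add: additive_def fps_shift_add)
  hence "fps_shift 1 \<in> carrier ?R"
    using shift by (simp add: bergman_ring_def bergman_carrierI)
  then obtain e u where e: "idempotent_elem ?R e" and u: "u \<in> Units ?R"
    and eu: "fps_shift 1 = e \<oplus>\<^bsub>?R\<^esub> u"
    using clean unfolding clean_ring_def by blast
  have "e \<in> bergman_carrier" and ee: "e \<circ> e = e"
    using e by (auto simp: idempotent_elem_def bergman_ring_def)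
  then obtain n p where n: "multiplier e n p" by (elim bergman_carrierE)
  have u_eq: "u a = fps_shift 1 a - e a" for a
    using fun_cong[OF eu, of a] by (simp add: bergman_ring_def)
  have "additive u" using u by (auto simp: Units_def bergman_ring_def bergman_carrier_def)
  moreover have "inj u"
  proof -
    obtain v where "v \<circ> u = id" using u by (auto simp: Units_def bergman_ring_def)
    thus ?thesis by (metis inj_on_id inj_on_imageI2)
  qed
  \<comment> \<open>The multiplier of \<open>u\<close> is \<open>1/X\<close> or
    \<open>1/X - 1\<close>, of valuation -1 in both cases. At exponent \<open>n + 1\<close> this
    leaves \<open>fps_X ^ n\<close> times the unit \<open>1\<close> or \<open>1 - fps_X\<close>, one
    power short of what injectivity demands.\<close>
  moreover obtain w where "fps_nth w 0 \<noteq> 0" "multiplier u (n + 1) (fps_X ^ n * w)"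
  proof -
    have *: "u (fps_X ^ (n + 1) * b) = (fps_X ^ n - fps_X * p) * b" for b
    proof -
      have "fps_shift 1 (fps_X ^ (1 + n) * b) = fps_X ^ n * b"
        using multiplier_mono[OF shift, of n] by (simp add: multiplier_def)
      moreover have "e (fps_X ^ (n + 1) * b) = fps_X * p * b"
        using multiplier_mono[OF n, of 1] by (simp add: multiplier_def)
      ultimately show ?thesis by (simp add: u_eq algebra_simps)
    qed
    show ?thesis
      using idempotent_multiplier[OF n ee]
    proof
      assume "p = 0"
      thus ?thesis using * by (intro that[of 1]) (auto simp: multiplier_def)
    next
      assume "p = fps_X ^ n"
      thus ?thesis using *
        by (intro that[of "1 - fps_X"]) (auto simp: multiplier_def algebra_simps)
    qed
  qed
  ultimately show False using inj_multiplier_subdegree_ge[of u "n + 1" n] by simp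
qed

theorem mainTheorem11:
  "\<exists>R :: ring_universe ring.
     ring R \<and> D_regularly_nil_clean R \<and> \<not> clean_ring R \<and> \<not> strongly_clean_ring R"
proof -
  let ?R = "bergman_ring :: ring_universe ring"
  interpret ring ?R by (rule ring_bergman_ring)
  have "D_regularly_nil_clean ?R"
    by (rule regular_imp_D_regularly_nil_clean)
       (use bergman_regular in \<open>auto simp: bergman_ring_def\<close>)
  moreover have "\<not> clean_ring ?R" by (rule bergman_ring_not_clean)
  moreover have "\<not> strongly_clean_ring ?R"
    using bergman_ring_not_clean unfolding clean_ring_def strongly_clean_ring_def by blast
  ultimately show ?thesis using ring_axioms by blast
qed

end
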